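(* (The Diamond Lemma II) Let $\mathbf k$ be a commutative ring, $V$ a free $\mathbf k$-module with basis $(v_i)_{i\in I}$ labeled by a partially ordered set $(I,\prec)$ satisfying the descending chain condition, $W\subseteq V$ a submodule, and $S=(w_j)_{j\in J}$ a confluent spanning set for $W$. Then one obtains another confluent spanning set $(u_{i,r})$ for $W$ by choosing, for each $i\in I$ such that $Y_i\ne(0)$, arbitrary elements $u_{i,r}\in\mathrm{Span}(S_i)$ of the form $u_{i,r}=\lambda_{i,r}v_i+\sum_{\ell\prec i}\mu_{i,\ell,r}v_\ell$ with $\lambda_{i,r}\ne0$, such that the $\lambda_{i,r}$ (for fixed $i$ and varying $r$) generate the ideal $Y_i$.
   Context: An element $w=\sum_i\lambda_iv_i\in V$ defines a reduction if there is a (unique) index $\psi\in I$ with $\lambda_\psi\ne0$ such that $\lambda_i\ne0$ implies $i\preceq\psi$; for $w_j$ write $\psi(j)$ for this index. For a family $S=(w_j)_{j\in J}$ of elements defining reductions, let $S_i=\{w_j:\psi(j)=i\}$, and $V_{\prec i}=\mathrm{Span}(v_\ell:\ell\prec i)$ (spans are $\mathbf k$-linear). $S$ is a confluent set if for all $i\in I$, $\mathrm{Span}(S_i)\cap V_{\prec i}\subseteq\mathrm{Span}\big(\bigcup_{\ell\prec i}S_\ell\big)$. It is a confluent spanning set for $W$ if moreover $S\subseteq W$ and $S$ spans $W$ over $\mathbf k$. $Y_i\subseteq\mathbf k$ is the ideal generated by all $\lambda\in\mathbf k$ such that some $w_j\in S$ has the form $w_j=\lambda v_i+\sum_{i'\prec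 i}\mu_{i'}v_{i'}$ with $\psi(j)=i$. *)

theory Defs
  imports Complex_Main
begin

text \<open>The ideals of \<open>'k\<close> are the submodules of \<open>'k\<close> acting on itself by multiplication.\<close>

definition ideal_generated :: "'k::comm_ring_1 set \<Rightarrow> 'k set" where
  "ideal_generated A = module.span (*) A"

text \<open>
  A free module over the commutative ring \<open>'k\<close>, with basis \<open>v i\<close> for \<open>i \<in> I\<close>, where \<open>prec\<close> is a
  strict partial order on \<open>I\<close> satisfying the descending chain condition. A family is linearly
  independent iff it is injective and its range is.
\<close>

locale ordered_free_module = module scale
  for scale :: "'k::comm_ring_1 \<Rightarrow> 'v::ab_group_add \<Rightarrow> 'v" (infixr "*s" 75) +
  fixes I :: "'i set"
    and prec :: "'i \<Rightarrow> 'i \<Rightarrow> bool" (infix "\<prec>" 50)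
    and v :: "'i \<Rightarrow> 'v"
  assumes prec_irrefl: "irreflp_on I prec"
    and prec_trans: "transp_on I prec"
    and prec_dcc: "\<not> (\<exists>f :: nat \<Rightarrow> 'i. \<forall>n. f n \<in> I \<and> f (Suc n) \<prec> f n)"
    and basis_inj: "inj_on v I"
    and basis_independent: "independent (v ` I)"
    and basis_span: "span (v ` I) = UNIV"
begin

definition coeff :: "'v \<Rightarrow> 'i \<Rightarrow> 'k" where
  "coeff w i = representation (v ` I) w (v i)"

definition is_leading_index :: "'v \<Rightarrow> 'i \<Rightarrow> bool" where
  "is_leading_index w p \<longleftrightarrow>
     p \<in> I \<and> coeff w p \<noteq> 0 \<and> (\<forall>i\<in>I. coeff w i \<noteq> 0 \<longrightarrow> i = p \<or> i \<prec> p)"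

definition defines_reduction :: "'v \<Rightarrow> bool" where
  "defines_reduction w \<longleftrightarrow> (\<exists>!p. is_leading_index w p)"

text \<open>The index \<open>\<psi>\<close> of an element; only meaningful if the element defines a reduction.\<close>

definition leading_index :: "'v \<Rightarrow> 'i" where
  "leading_index w = (THE p. is_leading_index w p)"

definition V_below :: "'i \<Rightarrow> 'v set" where
  "V_below i = span {v l | l. l \<in> I \<and> l \<prec> i}"

definition layer :: "'j set \<Rightarrow> ('j \<Rightarrow> 'v) \<Rightarrow> 'i \<Rightarrow> 'v set" where
  "layer J w i = {w j | j. j \<in> J \<and> leading_index (w j) = i}"

definition confluent_set :: "'j set \<Rightarrow> ('j \<Rightarrow> 'v) \<Rightarrow> bool" where
  "confluent_set J w \<longleftrightarrow>
     (\<forall>j\<in>J. defines_reduction (w j)) \<and>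
     (\<forall>i\<in>I. span (layer J w i) \<inter> V_below i \<subseteq> span (\<Union>l\<in>{l\<in>I. l \<prec> i}. layer J w l))"

definition confluent_spanning_set :: "'v set \<Rightarrow> 'j set \<Rightarrow> ('j \<Rightarrow> 'v) \<Rightarrow> bool" where
  "confluent_spanning_set W J w \<longleftrightarrow> confluent_set J w \<and> w ` J \<subseteq> W \<and> span (w ` J) = W"

definition leading_coeff_ideal :: "'j set \<Rightarrow> ('j \<Rightarrow> 'v) \<Rightarrow> 'i \<Rightarrow> 'k set" where
  "leading_coeff_ideal J w i =
     ideal_generated
       {a. \<exists>j\<in>J. leading_index (w j) = i \<and> (\<exists>x\<in>V_below i. w j = a *s v i + x)}"

end

end

theory Submission
  imports Defs
begin

text \<open>
  Subtract from a member of \<open>S\<^sub>i\<close> a combination of the \<open>u\<^sub>i\<^sub>,\<^sub>r\<close> with the same leading coefficient. The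
  difference lies in \<open>Span(S\<^sub>i) \<inter> V\<^sub>\<prec>\<^sub>i\<close>, hence, by confluence of \<open>S\<close>, in the span of the lower
  layers \<open>S\<^sub>l\<close>. Well-founded induction on \<open>i\<close> thus puts \<open>S\<^sub>i\<close> into the span of the \<open>u\<^sub>l\<^sub>,\<^sub>r\<close> with
  \<open>l \<preceq> i\<close>, which gives both the spanning property and the confluence of the new family.
\<close>

context ordered_free_module
begin

lemma prec_induct [consumes 1, case_names less]:
  assumes "i \<in> I"
    and step: "\<And>i. i \<in> I \<Longrightarrow> (\<And>l. l \<in> I \<Longrightarrow> l \<prec> i \<Longrightarrow> P l) \<Longrightarrow> P i"
  shows "P i"
proof -
  \<comment> \<open>The relation is restricted to \<open>I\<close>, so an infinite descending chain
    for it stays in \<open>I\<close> and is excluded by \<open>prec_dcc\<close>.\<close>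
  have "wf {(l, i). l \<in> I \<and> i \<in> I \<and> l \<prec> i}"
    using prec_dcc unfolding wf_iff_no_infinite_down_chain by blast
  then have "i \<in> I \<longrightarrow> P i"
    by (induction i rule: wf_induct_rule) (use step in blast)
  with \<open>i \<in> I\<close> show ?thesis by blast
qed

section \<open>Coefficients and leading terms\<close>

lemma coeff_add: "coeff (x + y) l = coeff x l + coeff y l"
  unfolding coeff_def
  using basis_independent basis_span by (simp add: representation_add)

lemma coeff_scale: "coeff (a *s x) l = a * coeff x l"
  unfolding coeff_def
  using basis_independent basis_span by (simp add: representation_scale)

lemma coeff_zero: "coeff 0 l = 0"
  unfolding coeff_def by (simp add: representation_zero)

lemma coeff_basis:
  assumes "i \<in> I" "l \<in> I"
  shows "coeff (v i) l = (if l = i then 1 else 0)"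
proof -
  have "v l = v i \<longleftrightarrow> l = i"
    using inj_on_eq_iff[OF basis_inj] assms by blast
  then show ?thesis
    unfolding coeff_def
    using basis_independent assms by (auto simp: representation_basis)
qed

lemma subspace_V_below: "subspace (V_below i)"
  unfolding V_below_def by (rule subspace_span)

lemma V_below_coeff:
  assumes "x \<in> V_below i" "l \<in> I" "\<not> l \<prec> i"
  shows "coeff x l = 0"
  using assms(1) unfolding V_below_def
proof (induction rule: span_induct)
  case base
  show ?case
    by (auto simp: subspace_def coeff_add coeff_scale coeff_zero)
next
  case (step x)
  then show ?case
    using assms by (auto simp: coeff_basis)
qed

text \<open>Two distinct leading indices would lie strictly below each other, against transitivity
  and irreflexivity. Hence exhibiting a leading index both proves \<open>defines_reduction\<close>
  and determines \<open>leading_index\<close>.\<close>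

lemma is_leading_index_unique:
  assumes "is_leading_index x p" "is_leading_index x q"
  shows "p = q"
  using assms prec_irrefl prec_trans unfolding is_leading_index_def
  by (metis irreflp_onD transp_onD)

lemma leading_index_eq:
  assumes "is_leading_index x p"
  shows "defines_reduction x" "leading_index x = p"
  unfolding defines_reduction_def leading_index_def
  using assms is_leading_index_unique by blast+

lemma is_leading_index_leading_index:
  assumes "defines_reduction x"
  shows "is_leading_index x (leading_index x)"
  using assms leading_index_eq(2) unfolding defines_reduction_def by metis

lemma is_leading_index_add_V_below:
  assumes "i \<in> I" "a \<noteq> 0" "x \<in> V_below i"
  shows "is_leading_index (a *s v i + x) i"
proof -
  have "\<not> i \<prec> i"
    using prec_irrefl \<open>i \<in> I\<close> by (meson irreflp_onD)
  then show ?thesis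
    unfolding is_leading_index_def
    using assms V_below_coeff
    by (auto simp: coeff_add coeff_scale coeff_basis split: if_splits)
qed

text \<open>In the basis expansion of \<open>x\<close>, every index other than \<open>p\<close> with
  nonzero coefficient is strictly below \<open>p\<close>. So removing the term at \<open>p\<close>
  leaves an element of \<open>V_below p\<close>.\<close>

lemma leading_term_decomp:
  assumes "is_leading_index x p"
  obtains y where "y \<in> V_below p" "x = coeff x p *s v p + y"
proof
  define B where "B = {b. representation (v ` I) x b \<noteq> 0}"
  have B: "finite B" "B \<subseteq> v ` I"
    unfolding B_def by (auto simp: finite_representation dest: representation_ne_zero)
  have p: "p \<in> I" "v p \<in> B"
    using assms unfolding is_leading_index_def B_def coeff_def by auto
  have "x = (\<Sum>b\<in>B. representation (v ` I) x b *s b)"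
    unfolding B_def
    using basis_independent basis_span by (simp add: sum_nonzero_representation_eq)
  also have "\<dots> = coeff x p *s v p + (\<Sum>b\<in>B - {v p}. representation (v ` I) x b *s b)"
    unfolding coeff_def using B p by (simp add: sum.remove)
  finally show "x = coeff x p *s v p + (\<Sum>b\<in>B - {v p}. representation (v ` I) x b *s b)" .
  show "(\<Sum>b\<in>B - {v p}. representation (v ` I) x b *s b) \<in> V_below p"
    unfolding V_below_def
  proof (intro span_sum span_scale)
    fix b assume b: "b \<in> B - {v p}"
    with B obtain l where l: "l \<in> I" "b = v l" by blast
    with b have "coeff x l \<noteq> 0" "l \<noteq> p"
      unfolding B_def coeff_def by auto
    with assms l have "l \<prec> p"
      unfolding is_leading_index_def by blast
    with l show "b \<in> span {v l |l. l \<in> I \<and> l \<prec> p}"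
      by (blast intro: span_base)
  qed
qed

section \<open>Lifting elements of the leading coefficient ideals\<close>

lemma ideal_generated_lift:
  assumes "a \<in> ideal_generated (c ` R)"
    and "\<And>r. r \<in> R \<Longrightarrow> \<exists>x\<in>V_below i. f r = c r *s v i + x"
  obtains y where "y \<in> span (f ` R)" "a *s v i - y \<in> V_below i"
proof -
  interpret ring: module "(*) :: 'k \<Rightarrow> 'k \<Rightarrow> 'k"
    by unfold_locales (simp_all add: algebra_simps)
  have "\<exists>y\<in>span (f ` R). a *s v i - y \<in> V_below i"
    using assms(1) unfolding ideal_generated_def
  proof (induction rule: ring.span_induct_alt)
    case base
    show ?case
      using subspace_0[OF subspace_V_below] by (auto intro: bexI[OF _ span_zero])
  next
    case (step d b a)
    then obtain r y where r: "r \<in> R" "b = c r"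
      and y: "y \<in> span (f ` R)" "a *s v i - y \<in> V_below i"
      by blast
    obtain x where x: "x \<in> V_below i" "f r = c r *s v i + x"
      using assms(2) r by blast
    \<comment> \<open>The ring combination is copied on the module side: \<open>d *s f r + y\<close>
      lifts \<open>d * b + a\<close>, at the cost of the error \<open>d *s x\<close> in
      \<open>V_below i\<close>.\<close>
    have "(d * b + a) *s v i - (d *s f r + y) = (a *s v i - y) - d *s x"
      by (simp add: x r algebra_simps)
    moreover have "\<dots> \<in> V_below i"
      by (intro subspace_diff[OF subspace_V_below] subspace_scale[OF subspace_V_below] x y)
    moreover have "d *s f r + y \<in> span (f ` R)"
      using r y by (intro span_add span_scale) (auto intro: span_base)
    ultimately show ?case by metis
  qed
  with that show ?thesis by blast
qed

lemma mem_leading_coeff_ideal: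
  assumes "j \<in> J" "is_leading_index (w j) i"
  shows "coeff (w j) i \<in> leading_coeff_ideal J w i"
proof -
  interpret ring: module "(*) :: 'k \<Rightarrow> 'k \<Rightarrow> 'k"
    by unfold_locales (simp_all add: algebra_simps)
  obtain x where "x \<in> V_below i" "w j = coeff (w j) i *s v i + x"
    using leading_term_decomp[OF assms(2)] .
  then show ?thesis
    unfolding leading_coeff_ideal_def ideal_generated_def
    using assms leading_index_eq(2) by (blast intro: ring.span_base)
qed

section \<open>Passing from one confluent spanning family to another\<close>

text \<open>The sets \<open>T i\<close> stand for the layers of the new family. The ideals enter
  only through \<open>lift\<close>, which says that \<open>T i\<close> can cancel any leading term
  occurring in layer \<open>i\<close> of \<open>w\<close>.\<close>

lemma layer_subset_span_lower:
  assumes confl: "confluent_set J w"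
    and T: "\<And>i. i \<in> I \<Longrightarrow> T i \<subseteq> span (layer J w i)"
    and lift: "\<And>i j. \<lbrakk>i \<in> I; j \<in> J; is_leading_index (w j) i\<rbrakk> \<Longrightarrow>
      \<exists>y\<in>span (T i). coeff (w j) i *s v i - y \<in> V_below i"
    and "i \<in> I"
  shows "layer J w i \<subseteq> span (\<Union>l\<in>{l\<in>I. l = i \<or> l \<prec> i}. T l)"
  using \<open>i \<in> I\<close>
proof (induction i rule: prec_induct)
  case (less i)
  define U where "U = span (\<Union>l\<in>{l\<in>I. l = i \<or> l \<prec> i}. T l)"
  have lower: "span (\<Union>l\<in>{l\<in>I. l \<prec> i}. layer J w l) \<subseteq> U"
  proof (rule span_minimal)
    show "(\<Union>l\<in>{l\<in>I. l \<prec> i}. layer J w l) \<subseteq> U"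
    proof (rule UN_least)
      fix l assume l: "l \<in> {l\<in>I. l \<prec> i}"
      \<comment> \<open>By transitivity, what the induction hypothesis gives for \<open>l\<close>
        only uses indices below \<open>i\<close>.\<close>
      have "{m\<in>I. m = l \<or> m \<prec> l} \<subseteq> {m\<in>I. m = i \<or> m \<prec> i}"
        using l \<open>i \<in> I\<close> prec_trans by (auto dest: transp_onD)
      then have "span (\<Union>m\<in>{m\<in>I. m = l \<or> m \<prec> l}. T m) \<subseteq> U"
        unfolding U_def by (intro span_mono UN_mono) auto
      with l less.IH show "layer J w l \<subseteq> U" by blast
    qed
  qed (simp add: U_def subspace_span)
  show ?case
  proof
    fix z assume z: "z \<in> layer J w i"
    then obtain j where j: "j \<in> J" "leading_index (w j) = i" "z = w j"
      unfolding layer_def by blast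
    then have lead: "is_leading_index (w j) i"
      using confl is_leading_index_leading_index unfolding confluent_set_def by blast
    obtain y where y: "y \<in> span (T i)" "coeff (w j) i *s v i - y \<in> V_below i"
      using lift less.hyps j(1) lead by blast
    obtain x where x: "x \<in> V_below i" "w j = coeff (w j) i *s v i + x"
      using leading_term_decomp[OF lead] .
    \<comment> \<open>Both \<open>w j\<close> and \<open>y\<close> agree with
      \<open>coeff (w j) i *s v i\<close> modulo \<open>V_below i\<close>, so the leading terms
      cancel.\<close>
    have "w j - y = (coeff (w j) i *s v i - y) + x"
      using x(2) by (simp add: algebra_simps)
    then have "w j - y \<in> V_below i"
      using subspace_add[OF subspace_V_below y(2) x(1)] by (simp only:)
    \<comment> \<open>The assumption on \<open>T\<close> keeps the difference inside the span of
      layer \<open>i\<close> of \<open>w\<close>, so that confluence of \<open>w\<close> applies to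
      it.\<close>
    moreover have "y \<in> span (layer J w i)"
      using y(1) span_minimal[OF T subspace_span] less.hyps by blast
    then have "w j - y \<in> span (layer J w i)"
      using z j by (auto intro: span_diff span_base)
    ultimately have "w j - y \<in> U"
      using confl less.hyps lower unfolding confluent_set_def by blast
    moreover have "y \<in> U"
      using y(1) less.hyps unfolding U_def by (blast intro: span_mono[THEN subsetD])
    ultimately have "(w j - y) + y \<in> U"
      unfolding U_def by (rule span_add)
    then show "z \<in> span (\<Union>l\<in>{l\<in>I. l = i \<or> l \<prec> i}. T l)"
      using j by (simp add: U_def)
  qed
qed

text \<open>Confluence is inherited in two moves: an element of \<open>span (layer K u i)\<close> in
  \<open>V_below i\<close> falls under the confluence of \<open>w\<close>, and each lower layer of
  \<open>w\<close> is then rewritten in layers of \<open>u\<close>.\<close>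

lemma confluent_spanning_set_transfer:
  fixes u :: "'s \<Rightarrow> 'v"
  assumes "confluent_spanning_set W J w"
    and red: "\<And>k. k \<in> K \<Longrightarrow> defines_reduction (u k)"
    and sub: "\<And>i. i \<in> I \<Longrightarrow> layer K u i \<subseteq> span (layer J w i)"
    and lift: "\<And>i j. \<lbrakk>i \<in> I; j \<in> J; is_leading_index (w j) i\<rbrakk> \<Longrightarrow>
      \<exists>y\<in>span (layer K u i). coeff (w j) i *s v i - y \<in> V_below i"
  shows "confluent_spanning_set W K u"
proof -
  have confl: "confluent_set J w" and span_w: "span (w ` J) = W"
    using assms(1) unfolding confluent_spanning_set_def by auto
  have layers: "layer J w i \<subseteq> span (\<Union>l\<in>{l\<in>I. l = i \<or> l \<prec> i}. layer K u l)" if "i \<in> I" for i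
    using layer_subset_span_lower[OF confl sub lift that] .
  have confl_u: "span (layer K u i) \<inter> V_below i \<subseteq> span (\<Union>l\<in>{l\<in>I. l \<prec> i}. layer K u l)"
    if "i \<in> I" for i
  proof -
    have "span (layer K u i) \<subseteq> span (layer J w i)"
      by (rule span_minimal[OF sub[OF that] subspace_span])
    then have "span (layer K u i) \<inter> V_below i \<subseteq> span (\<Union>l\<in>{l\<in>I. l \<prec> i}. layer J w l)"
      using confl that unfolding confluent_set_def by blast
    also have "\<dots> \<subseteq> span (\<Union>l\<in>{l\<in>I. l \<prec> i}. layer K u l)"
    proof (intro span_minimal UN_least subspace_span)
      fix l assume l: "l \<in> {l\<in>I. l \<prec> i}"
      \<comment> \<open>Since \<open>l\<close> is strictly below \<open>i\<close>, allowing
        \<open>m = l\<close> still keeps all indices strictly below \<open>i\<close>, as confluence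
        demands.\<close>
      have "{m\<in>I. m = l \<or> m \<prec> l} \<subseteq> {m\<in>I. m \<prec> i}"
        using l \<open>i \<in> I\<close> prec_trans by (auto dest: transp_onD)
      then have "span (\<Union>m\<in>{m\<in>I. m = l \<or> m \<prec> l}. layer K u m)
          \<subseteq> span (\<Union>m\<in>{m\<in>I. m \<prec> i}. layer K u m)"
        by (intro span_mono UN_mono) auto
      with l layers show "layer J w l \<subseteq> span (\<Union>m\<in>{m\<in>I. m \<prec> i}. layer K u m)"
        by blast
    qed
    finally show ?thesis .
  qed
  have sub_W: "u ` K \<subseteq> W"
  proof
    fix z assume "z \<in> u ` K"
    then obtain k where k: "k \<in> K" "z = u k" by blast
    define i where "i = leading_index (u k)"
    have "i \<in> I"
      using is_leading_index_leading_index[OF red[OF k(1)]]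
      unfolding i_def is_leading_index_def by blast
    moreover have "z \<in> layer K u i"
      unfolding layer_def i_def using k by blast
    moreover have "span (layer J w i) \<subseteq> span (w ` J)"
      by (rule span_mono) (auto simp: layer_def)
    ultimately show "z \<in> W"
      using sub span_w by blast
  qed
  have "w ` J \<subseteq> span (u ` K)"
  proof
    fix z assume "z \<in> w ` J"
    then obtain j where j: "j \<in> J" "z = w j" by blast
    \<comment> \<open>Each \<open>w j\<close> lies in the layer of its own leading index, so the
      layerwise inclusions cover the whole family.\<close>
    define i where "i = leading_index (w j)"
    have "defines_reduction (w j)"
      using confl j unfolding confluent_set_def by blast
    then have "i \<in> I"
      using is_leading_index_leading_index unfolding i_def is_leading_index_def by blast
    moreover have "z \<in> layer J w i"
      unfolding layer_def i_def using j by blast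
    moreover have "span (\<Union>l\<in>{l\<in>I. l = i \<or> l \<prec> i}. layer K u l) \<subseteq> span (u ` K)"
      by (rule span_mono) (auto simp: layer_def)
    ultimately show "z \<in> span (u ` K)"
      using layers by blast
  qed
  then have "W \<subseteq> span (u ` K)"
    using span_minimal subspace_span span_w by blast
  moreover have "span (u ` K) \<subseteq> W"
    using span_minimal[OF sub_W] subspace_span span_w by blast
  ultimately show ?thesis
    unfolding confluent_spanning_set_def confluent_set_def
    using red confl_u sub_W by blast
qed

end

theorem propositionA2p4:
  fixes scale :: "'k::comm_ring_1 \<Rightarrow> 'v::ab_group_add \<Rightarrow> 'v"
    and I :: "'i set" and prec :: "'i \<Rightarrow> 'i \<Rightarrow> bool" and v :: "'i \<Rightarrow> 'v"
    and W :: "'v set"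
    and J :: "'j set" and w :: "'j \<Rightarrow> 'v"
    and Y :: "'i \<Rightarrow> 'k set"
    and R :: "'i \<Rightarrow> 'r set" and u :: "'i \<Rightarrow> 'r \<Rightarrow> 'v" and c :: "'i \<Rightarrow> 'r \<Rightarrow> 'k"
  assumes "ordered_free_module scale I prec v"
    and "module.subspace scale W"
    and "ordered_free_module.confluent_spanning_set scale I prec v W J w"
    and Y_def: "\<And>i. Y i = ordered_free_module.leading_coeff_ideal scale I prec v J w i"
    and u_span: "\<And>i r. i \<in> I \<Longrightarrow> Y i \<noteq> {0} \<Longrightarrow> r \<in> R i \<Longrightarrow>
          u i r \<in> module.span scale (ordered_free_module.layer scale I prec v J w i)"
    and u_form: "\<And>i r. i \<in> I \<Longrightarrow> Y i \<noteq> {0} \<Longrightarrow> r \<in> R i \<Longrightarrow>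
          \<exists>x\<in>ordered_free_module.V_below scale I prec v i. u i r = scale (c i r) (v i) + x"
    and c_nonzero: "\<And>i r. i \<in> I \<Longrightarrow> Y i \<noteq> {0} \<Longrightarrow> r \<in> R i \<Longrightarrow> c i r \<noteq> 0"
    and c_generates: "\<And>i. i \<in> I \<Longrightarrow> Y i \<noteq> {0} \<Longrightarrow>
          ideal_generated (c i ` R i) = Y i"
  shows "ordered_free_module.confluent_spanning_set scale I prec v W
           (SIGMA i:{i\<in>I. Y i \<noteq> {0}}. R i) (\<lambda>(i, r). u i r)"
proof -
  interpret ordered_free_module scale I prec v by fact
  let ?K = "SIGMA i:{i\<in>I. Y i \<noteq> {0}}. R i"
  let ?u = "\<lambda>(i, r). u i r"
  have lead: "is_leading_index (u i r) i" if "i \<in> I" "Y i \<noteq> {0}" "r \<in> R i" for i r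
    using u_form[OF that] c_nonzero[OF that] is_leading_index_add_V_below that(1) by force
  note lead_props = leading_index_eq[OF lead]
  have layer_u: "layer ?K ?u i = (if Y i = {0} then {} else u i ` R i)" if "i \<in> I" for i
  proof -
    have index_iff: "l \<in> I \<and> Y l \<noteq> {0} \<and> r \<in> R l \<and> leading_index (u l r) = i
        \<longleftrightarrow> l = i \<and> Y i \<noteq> {0} \<and> r \<in> R i" for l r
      using lead_props(2) that by metis
    have "layer ?K ?u i = {u l r |l r. l \<in> I \<and> Y l \<noteq> {0} \<and> r \<in> R l \<and> leading_index (u l r) = i}"
      by (simp add: layer_def conj_assoc)
    also have "\<dots> = {u i r |r. Y i \<noteq> {0} \<and> r \<in> R i}"
      by (simp only: index_iff) blast
    also have "\<dots> = (if Y i = {0} then {} else u i ` R i)"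
      by (simp add: image_def) blast
    finally show ?thesis .
  qed
  show ?thesis
  proof (rule confluent_spanning_set_transfer)
    show "confluent_spanning_set W J w" by fact
    show "defines_reduction (?u k)" if "k \<in> ?K" for k
      using that by (cases k) (simp add: lead_props(1))
    show "layer ?K ?u i \<subseteq> span (layer J w i)" if "i \<in> I" for i
      using u_span[OF that] by (simp add: layer_u[OF that] image_subset_iff)
    fix i j assume ij: "i \<in> I" "j \<in> J" "is_leading_index (w j) i"
    have mem: "coeff (w j) i \<in> Y i"
      unfolding Y_def using ij(2,3) by (rule mem_leading_coeff_ideal)
    moreover have "coeff (w j) i \<noteq> 0"
      using ij unfolding is_leading_index_def by blast
    \<comment> \<open>A layer of \<open>w\<close> with a member has a nonzero leading coefficient in
      \<open>Y i\<close>. So leading terms to be lifted occur only at indices where elements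
      \<open>u i r\<close> were chosen.\<close>
    ultimately have Y: "Y i \<noteq> {0}" by (metis singletonD)
    have "coeff (w j) i \<in> ideal_generated (c i ` R i)"
      unfolding c_generates[OF ij(1) Y] by (rule mem)
    then obtain y where "y \<in> span (u i ` R i)" "scale (coeff (w j) i) (v i) - y \<in> V_below i"
      using u_form[OF ij(1) Y] by (rule ideal_generated_lift)
    then show "\<exists>y\<in>span (layer ?K ?u i). scale (coeff (w j) i) (v i) - y \<in> V_below i"
      unfolding layer_u[OF ij(1)] if_not_P[OF Y] by (rule bexI[rotated])
  qed
qed

end
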